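(* Suppose that $h \in C^0((0,\infty))$ is real-valued with $h(s) > 0$ for all $s > 0$. Let $a, t_* \in \mathbb{R}$ with $a + 1 < t_*$. Assume that $z \in C^0([a,t_* )) \cap C^1([a+1,t_* ))$, that $z(t) > 0$ for all $t \in [a,t_* )$, and that $$\frac{dz}{dt}(t) = (z(t))^2\, h(z(t-1)) \quad \text{for all } a+1 \le t < t_*.$$ If $z(t) \to \infty$ as $t \to t_*^-$, then $$z(t) = \frac{c}{t_* - t} + o\!\left(\frac{1}{t_* - t}\right) \quad \text{as } t \to t_*^-,$$ where $c := h(z(t_* - 1))^{-1} > 0$.
   Context: $z \in C^0([a,t_* )) \cap C^1([a+1,t_* ))$ means that $z$ is a real-valued continuous function on $[a,t_* )$ whose restriction to $[a+1,t_* )$ is continuously differentiable, with the derivative at $a+1$ understood as one-sided (right) derivative. $o(\cdot)$ is Landau's symbol, and $t \to t_*^-$ means $t$ tends to $t_*$ from the left. *)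

theory Defs
  imports "HOL-Analysis.Analysis" "HOL-Library.Landau_Symbols"
begin

end

theory Submission
  imports Defs
begin

text \<open>The delay turns the equation into a Riccati equation \<open>z' = k z\<^sup>2\<close> whose coefficient
  \<open>k t = h (z (t - 1))\<close> only involves values of \<open>z\<close> a full unit before the blow-up time \<open>T\<close>.
  There \<open>z\<close> is still finite, positive and continuous, so \<open>k\<close> converges to
  \<open>K = h (z (T - 1)) > 0\<close> as \<open>t\<close> tends to \<open>T\<close> from the left.  The substitution \<open>w = 1 / z\<close>
  linearises the Riccati equation: \<open>w' = - k\<close> and \<open>w\<close> tends to \<open>0\<close> at \<open>T\<close>.  Hence \<open>w\<close> vanishes
  at \<open>T\<close> with slope \<open>- K\<close>, that is, \<open>w t / (T - t)\<close> tends to \<open>K\<close>, by l'Hopital's rule.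
  Inverting, \<open>(T - t) z t\<close> tends to \<open>1 / K\<close> (lemma \<open>riccati_blow_up_rate\<close>), which is the
  asserted expansion multiplied by \<open>T - t\<close>.\<close>

text \<open>The reciprocal \<open>1 / z\<close> has derivative \<open>- k\<close> and tends to \<open>0\<close>, so comparing it with
  \<open>T - t\<close> by l'Hopital's rule reduces the blow-up rate to the limit of \<open>k\<close>.\<close>

lemma riccati_blow_up_rate:
  fixes z k :: "real \<Rightarrow> real" and T K :: real
  assumes ode: "\<forall>\<^sub>F t in at_left T. (z has_real_derivative (z t)\<^sup>2 * k t) (at t)"
    and k_lim: "(k \<longlongrightarrow> K) (at_left T)"
    and K_nz: "K \<noteq> 0"
    and blow_up: "filterlim z at_top (at_left T)"
  shows "((\<lambda>t. (T - t) * z t) \<longlongrightarrow> inverse K) (at_left T)"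
proof -
  have z_pos: "\<forall>\<^sub>F t in at_left T. z t > 0"
    using blow_up by (simp add: filterlim_at_top_dense)
  have recip_deriv: "\<forall>\<^sub>F t in at_left T. ((\<lambda>t. inverse (z t)) has_real_derivative - k t) (at t)"
    using ode z_pos
  proof eventually_elim
    case (elim t)
    then show ?case
      by (auto intro!: derivative_eq_intros simp: power2_eq_square field_simps)
  qed
  have recip_lim: "((\<lambda>t. inverse (z t)) \<longlongrightarrow> 0) (at_left T)"
    using blow_up by (rule tendsto_inverse_0_at_top)
  have gap_lim: "((\<lambda>t. T - t) \<longlongrightarrow> 0) (at_left T)"
    by (auto intro!: tendsto_eq_intros)
  have gap_pos: "\<forall>\<^sub>F t in at_left T. T - t \<noteq> 0"
    by (auto simp: eventually_at_filter)
  have "((\<lambda>t. inverse (z t) / (T - t)) \<longlongrightarrow> K) (at_left T)"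
  proof (rule lhopital_left[where f' = "\<lambda>t. - k t" and g' = "\<lambda>_. -1"])
    show "\<forall>\<^sub>F t in at_left T. ((\<lambda>t. T - t) has_real_derivative -1) (at t)"
      by (auto intro!: always_eventually derivative_eq_intros)
  qed (use recip_lim gap_lim gap_pos recip_deriv k_lim in auto)
  then have "((\<lambda>t. inverse (inverse (z t) / (T - t))) \<longlongrightarrow> inverse K) (at_left T)"
    using K_nz by (rule tendsto_inverse)
  then show ?thesis
    by (simp add: field_simps)
qed

theorem theorem5p1:
  fixes h z z' :: "real \<Rightarrow> real" and a t_star :: real
  assumes h_cont: "continuous_on {0<..} h"
    and h_pos: "\<And>s. s > 0 \<Longrightarrow> h s > 0"
    and a_less: "a + 1 < t_star"
    and z_cont: "continuous_on {a..<t_star} z"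
    and z_deriv: "\<And>t. t \<in> {a + 1..<t_star} \<Longrightarrow>
          (z has_real_derivative z' t) (at t within {a + 1..<t_star})"
    and z'_cont: "continuous_on {a + 1..<t_star} z'"
    and z_pos: "\<And>t. t \<in> {a..<t_star} \<Longrightarrow> z t > 0"
    and dde: "\<And>t. t \<in> {a + 1..<t_star} \<Longrightarrow> z' t = (z t)\<^sup>2 * h (z (t - 1))"
    and blow_up: "filterlim z at_top (at_left t_star)"
  shows "let c = inverse (h (z (t_star - 1))) in
           c > 0 \<and>
           (\<lambda>t. z t - c / (t_star - t)) \<in> o[at_left t_star](\<lambda>t. 1 / (t_star - t))"
proof -
  define K where "K = h (z (t_star - 1))"
  have z_delay_pos: "z (t_star - 1) > 0"
    using z_pos a_less by simp
  then have K_pos: "K > 0"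
    unfolding K_def by (rule h_pos)
  have interior: "\<forall>\<^sub>F t in at_left t_star. t \<in> {a + 1<..<t_star}"
    using a_less by (rule eventually_at_left_real)
  have ode: "\<forall>\<^sub>F t in at_left t_star.
      (z has_real_derivative (z t)\<^sup>2 * h (z (t - 1))) (at t)"
    using interior
  proof eventually_elim
    case (elim t)
    then have "at t within {a + 1..<t_star} = at t"
      by (intro at_within_interior) simp
    with elim z_deriv[of t] dde[of t] show ?case
      by simp
  qed
  have "((\<lambda>t. h (z (t - 1))) \<longlongrightarrow> K) (at_left t_star)"
  proof -
    have "isCont z (t_star - 1)"
      using z_cont a_less by (intro continuous_on_interior[of "{a..<t_star}"]) simp_all
    moreover have "((\<lambda>t. t - 1) \<longlongrightarrow> t_star - 1) (at_left t_star)"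
      by (auto intro!: tendsto_eq_intros)
    ultimately have "((\<lambda>t. z (t - 1)) \<longlongrightarrow> z (t_star - 1)) (at_left t_star)"
      by (rule isCont_tendsto_compose)
    moreover have "isCont h (z (t_star - 1))"
      using h_cont z_delay_pos by (simp add: continuous_on_eq_continuous_at)
    ultimately show ?thesis
      unfolding K_def by (intro isCont_tendsto_compose[of _ h])
  qed
  with ode K_pos blow_up have
    rate: "((\<lambda>t. (t_star - t) * z t) \<longlongrightarrow> inverse K) (at_left t_star)"
    by (intro riccati_blow_up_rate[where k = "\<lambda>t. h (z (t - 1))"]) auto
  have gap_nz: "\<forall>\<^sub>F t in at_left t_star. t_star - t \<noteq> 0"
    by (auto simp: eventually_at_filter)
  have "(\<lambda>t. z t - inverse K / (t_star - t)) \<in> o[at_left t_star](\<lambda>t. 1 / (t_star - t))"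
  proof (rule smalloI_tendsto)
    have "((\<lambda>t. (t_star - t) * z t - inverse K) \<longlongrightarrow> 0) (at_left t_star)"
      using rate by (simp add: LIM_zero_iff)
    moreover have "\<forall>\<^sub>F t in at_left t_star. (t_star - t) * z t - inverse K =
        (z t - inverse K / (t_star - t)) / (1 / (t_star - t))"
      using gap_nz by eventually_elim (simp add: left_diff_distrib[where a = "z _"] mult.commute[of _ "z _"])
    ultimately show "((\<lambda>t. (z t - inverse K / (t_star - t)) / (1 / (t_star - t))) \<longlongrightarrow> 0)
        (at_left t_star)"
      by (rule Lim_transform_eventually)
    show "\<forall>\<^sub>F t in at_left t_star. 1 / (t_star - t) \<noteq> 0"
      using gap_nz by eventually_elim simp
  qed
  with K_pos show ?thesis
    by (simp add: K_def Let_def)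
qed

end
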